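(* Let $G$ be a finite simple undirected graph with $N$ nodes, let $\{Z(t)\}$ be the heat diffusion process on $G$ with initial distribution $p(0)$, and let $t\ge 0$. Let $\mathbf{p}^{(i)}$ denote the $i$-th row of the transition matrix $\mathbf{T}(0,t)$ and let $\boldsymbol{\pi}=(\tfrac1N,\dots,\tfrac1N)$ be the uniform distribution. Then for every real $q\ge 1$, $$\log(N)-H(Z(t)\mid Z(0))\ \ge\ \sum_i\frac{p_i(0)}{2}\,\big\|\mathbf{p}^{(i)}-\boldsymbol{\pi}\big\|_q^2,$$ where $\|\cdot\|_q$ is the $\ell^q$-norm on $\mathbb{R}^N$.
   Context: The combinatorial Laplacian $\mathbf{L}$ of a graph has entries $L_{i,i}=d_i$ (the degree of node $i$), $L_{i,j}=-1$ if $i\neq j$ and $i,j$ are joined by an edge, and $L_{i,j}=0$ otherwise. Heat diffusion is the continuous-time homogeneous Markov chain on the nodes whose probability vector satisfies $\frac{d}{dt}\mathbf{p}^{\intercal}(t)=-\mathbf{p}^{\intercal}(t)\mathbf{L}$ (diffusion rate equal to 1), so its transition matrix from time $0$ to time $t$ is $\mathbf{T}(0,t)=e^{-t\mathbf{L}}$. The conditional entropy is $H(Z(t)\mid Z(0))=\sum_i p_i(0)H_i(t\mid 0)$, where $p_i(0)$ is the probability that $Z(0)$ is node $i$ and $H_i(t\mid 0)=-\sum_j T_{i,j}(0,t)\log T_{i,j}(0,t)$. Logarithms are natural and $0\log 0=0$. *)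

theory Defs
  imports "HOL-Analysis.Analysis" "HOL-Probability.Probability"
begin

text \<open>
  A finite simple undirected graph is a symmetric irreflexive adjacency relation \<open>E\<close> on a finite
  type \<open>'n\<close> of nodes, so that \<open>N = CARD('n)\<close>.
\<close>

locale simple_graph =
  fixes E :: "'n::finite \<Rightarrow> 'n \<Rightarrow> bool"
  assumes symp_adj: "symp E"
    and irreflp_adj: "irreflp E"

definition degree :: "('n::finite \<Rightarrow> 'n \<Rightarrow> bool) \<Rightarrow> 'n \<Rightarrow> nat" where
  "degree E i = card {j. E i j}"

definition laplacian :: "('n::finite \<Rightarrow> 'n \<Rightarrow> bool) \<Rightarrow> real^'n^'n" where
  "laplacian E = (\<chi> i j. if i = j then real (degree E i) else if E i j then -1 else 0)"


subsection \<open>Matrix exponential\<close>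

text \<open>
  The class operations \<open>(*)\<close>, \<open>(^)\<close> on \<^typ>\<open>real^'n^'n\<close> are componentwise, so neither matrix powers
  nor the library's \<^const>\<open>exp\<close> can be used here.
\<close>

definition mat_pow :: "real^'n^'n \<Rightarrow> nat \<Rightarrow> real^'n^'n" where
  "mat_pow A k = (((**) A) ^^ k) (mat 1)"

definition mat_exp :: "real^'n^'n \<Rightarrow> real^'n^'n" where
  "mat_exp A = (\<Sum>k. (1 / fact k) *\<^sub>R mat_pow A k)"

definition transition_matrix :: "('n::finite \<Rightarrow> 'n \<Rightarrow> bool) \<Rightarrow> real \<Rightarrow> real \<Rightarrow> real^'n^'n" where
  "transition_matrix E s t = mat_exp (- (t - s) *\<^sub>R laplacian E)"

lemma mat_pow_Suc: "mat_pow A (Suc k) = A ** mat_pow A k"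
  by (simp add: mat_pow_def)

lemma mat_pow_Suc2: "mat_pow A (Suc k) = mat_pow A k ** A"
  by (induction k) (simp_all add: mat_pow_def matrix_mul_assoc)

lemma mat_pow_scaleR: "mat_pow (c *\<^sub>R A) k = c ^ k *\<^sub>R mat_pow A k"
proof (induction k)
  case 0
  then show ?case by (simp add: mat_pow_def)
next
  case (Suc k)
  have "(c *\<^sub>R A) ** (c ^ k *\<^sub>R mat_pow A k) = c ^ Suc k *\<^sub>R (A ** mat_pow A k)"
    by (simp add: matrix_matrix_mult_def vec_eq_iff sum_distrib_left mult_ac)
  then show ?case using Suc by (simp add: mat_pow_Suc)
qed

lemma summable_mat_exp:
  fixes A :: "real^'n^'n"
  shows "summable (\<lambda>k. (1 / fact k) *\<^sub>R mat_pow A k)"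
proof -
  have "linear (\<lambda>B::real^'n^'n. A ** B)"
    by (rule linearI)
      (simp_all add: matrix_matrix_mult_def vec_eq_iff algebra_simps sum.distrib sum_distrib_left)
  then have "bounded_linear (\<lambda>B::real^'n^'n. A ** B)"
    by (simp add: linear_conv_bounded_linear)
  then obtain K where K: "K > 0" "\<And>B::real^'n^'n. norm (A ** B) \<le> norm B * K"
    using bounded_linear.pos_bounded by blast
  have bound: "norm (mat_pow A k) \<le> norm (mat 1 :: real^'n^'n) * K ^ k" for k
  proof (induction k)
    case 0
    then show ?case by (simp add: mat_pow_def)
  next
    case (Suc k)
    have "norm (mat_pow A (Suc k)) \<le> norm (mat_pow A k) * K"
      unfolding mat_pow_Suc by (rule K(2))
    also have "\<dots> \<le> (norm (mat 1 :: real^'n^'n) * K ^ k) * K"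
      using Suc K(1) by (intro mult_right_mono) auto
    finally show ?case by (simp add: mult_ac)
  qed
  have "summable (\<lambda>k. norm (mat 1 :: real^'n^'n) * (inverse (fact k) * K ^ k))"
    by (intro summable_mult summable_exp)
  then show ?thesis
    by (rule summable_comparison_test')
      (use bound in \<open>auto simp: field_simps intro!: divide_right_mono\<close>)
qed

lemma has_vector_derivative_mat_exp:
  fixes A :: "real^'n^'n"
  shows "((\<lambda>t. mat_exp (t *\<^sub>R A)) has_vector_derivative (mat_exp (t *\<^sub>R A) ** A)) (at t)"
proof -
  have nth: "bounded_linear (\<lambda>B::real^'n^'n. B $ i $ j)" for i j
    by (intro bounded_linear_compose[OF bounded_linear_vec_nth bounded_linear_vec_nth])
  have nthA: "bounded_linear (\<lambda>B::real^'n^'n. (B ** A) $ i $ j)" for i j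
  proof -
    have "linear (\<lambda>B::real^'n^'n. (B ** A) $ i $ j)"
      by (rule linearI)
        (simp_all add: matrix_matrix_mult_def algebra_simps sum.distrib sum_distrib_left)
    then show ?thesis by (simp add: linear_conv_bounded_linear)
  qed
  have *: "((\<lambda>t. mat_exp (t *\<^sub>R A) $ i $ j) has_real_derivative (mat_exp (t *\<^sub>R A) ** A) $ i $ j) (at t)"
    for i j
  proof -
    define c where "c k = mat_pow A k $ i $ j / fact k" for k
    have trm: "((1 / fact k) *\<^sub>R mat_pow (y *\<^sub>R A) k) $ i $ j = c k * y ^ k" for y k
      by (simp add: c_def mat_pow_scaleR)
    have sm: "summable (\<lambda>k. c k * y ^ k)" for y
      using bounded_linear.summable[OF nth[of i j] summable_mat_exp[of "y *\<^sub>R A"]] by (simp only: trm)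
    have ex: "mat_exp (y *\<^sub>R A) $ i $ j = (\<Sum>k. c k * y ^ k)" for y
      unfolding mat_exp_def
      using bounded_linear.suminf[OF nth[of i j] summable_mat_exp[of "y *\<^sub>R A"]] by (simp only: trm)
    have "(((1 / fact k) *\<^sub>R mat_pow (t *\<^sub>R A) k) ** A) $ i $ j = diffs c k * t ^ k" for k
    proof -
      have "(((1 / fact k) *\<^sub>R mat_pow (t *\<^sub>R A) k) ** A) $ i $ j
          = t ^ k / fact k * (mat_pow A k ** A) $ i $ j"
        by (simp add: mat_pow_scaleR matrix_matrix_mult_def sum_distrib_left mult_ac)
      also have "\<dots> = diffs c k * t ^ k"
        by (simp add: diffs_def c_def mat_pow_Suc2 del: of_nat_Suc)
      finally show ?thesis .
    qed
    then have "(mat_exp (t *\<^sub>R A) ** A) $ i $ j = (\<Sum>k. diffs c k * t ^ k)"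
      unfolding mat_exp_def
      using bounded_linear.suminf[OF nthA[of i j] summable_mat_exp[of "t *\<^sub>R A"]] by simp
    then show ?thesis
      unfolding ex using termdiffs_strong_converges_everywhere[OF sm, of t] by simp
  qed
  have "((\<lambda>t. mat_exp (t *\<^sub>R A)) has_derivative (\<lambda>x. x *\<^sub>R (mat_exp (t *\<^sub>R A) ** A))) (at t)"
  proof (subst has_derivative_componentwise_within, rule ballI)
    fix b :: "real^'n^'n" assume "b \<in> Basis"
    then obtain i j where b: "b = axis i (axis j 1)"
      by (auto simp: Basis_vec_def)
    have "B \<bullet> b = B $ i $ j" for B
      by (simp add: b inner_axis)
    then show "((\<lambda>t. mat_exp (t *\<^sub>R A) \<bullet> b) has_derivative
        (\<lambda>x. x *\<^sub>R (mat_exp (t *\<^sub>R A) ** A) \<bullet> b)) (at t)"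
      using *[of i j] by (simp add: has_field_derivative_def mult_commute_abs)
  qed
  then show ?thesis
    by (simp add: has_vector_derivative_def)
qed

text \<open>The probability vector \<open>p(t)\<close> satisfies the heat equation \<open>dp/dt = - p L\<close>.\<close>

lemma heat_equation:
  fixes p0 :: "real^'n"
  shows "((\<lambda>t. p0 v* transition_matrix E 0 t) has_vector_derivative
           - ((p0 v* transition_matrix E 0 t) v* laplacian E)) (at t)"
proof -
  have "linear (\<lambda>B::real^'n^'n. p0 v* B)"
    by (rule linearI)
      (simp_all add: vector_matrix_mult_def vec_eq_iff algebra_simps sum.distrib sum_distrib_left)
  then have bl: "bounded_linear (\<lambda>B::real^'n^'n. p0 v* B)"
    by (simp add: linear_conv_bounded_linear)
  have tm: "transition_matrix E 0 t = mat_exp (t *\<^sub>R (- laplacian E))" for t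
    by (simp add: transition_matrix_def)
  have "p0 v* (mat_exp (t *\<^sub>R (- laplacian E)) ** (- laplacian E))
      = - ((p0 v* mat_exp (t *\<^sub>R (- laplacian E))) v* laplacian E)"
    by (simp add: vector_matrix_mul_assoc[symmetric])
      (simp add: vector_matrix_mult_def vec_eq_iff sum_negf)
  then show ?thesis
    unfolding tm
    using bounded_linear.has_vector_derivative[OF bl has_vector_derivative_mat_exp[of "- laplacian E" t]]
    by simp
qed


subsection \<open>Heat diffusion\<close>

text \<open>
  The Markov property is stated in product form, \<open>P(F, Z(s)=i, Z(t)=j) = P(F, Z(s)=i) T(s,t)\<^sub>i\<^sub>j\<close> for
  an event \<open>F\<close> fixing \<open>Z\<close> at finitely many earlier times, which avoids conditioning on null
  events. For \<open>0 < P(F, Z(s)=i)\<close> it says \<open>P(Z(t)=j | F, Z(s)=i) = T(s,t)\<^sub>i\<^sub>j\<close>.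
\<close>

locale heat_diffusion = simple_graph E + prob_space M
  for E :: "'n::finite \<Rightarrow> 'n \<Rightarrow> bool" and M :: "'w measure" +
  fixes p0 :: "real^'n" and Z :: "real \<Rightarrow> 'w \<Rightarrow> 'n"
  assumes Z_measurable: "t \<ge> 0 \<Longrightarrow> Z t \<in> measurable M (count_space UNIV)"
    and initial: "prob {w \<in> space M. Z 0 w = i} = p0 $ i"
    and markov: "0 \<le> s \<Longrightarrow> s \<le> t \<Longrightarrow> finite S \<Longrightarrow> S \<subseteq> {0..s} \<Longrightarrow>
      prob {w \<in> space M. (\<forall>u\<in>S. Z u w = x u) \<and> Z s w = i \<and> Z t w = j}
      = prob {w \<in> space M. (\<forall>u\<in>S. Z u w = x u) \<and> Z s w = i} * transition_matrix E s t $ i $ j"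

text \<open>\<open>0 log 0 = 0\<close> holds because \<open>ln 0 = 0\<close>.\<close>

definition row_entropy :: "('n::finite \<Rightarrow> 'n \<Rightarrow> bool) \<Rightarrow> real \<Rightarrow> 'n \<Rightarrow> real" where
  "row_entropy E t i =
     - (\<Sum>j\<in>UNIV. transition_matrix E 0 t $ i $ j * ln (transition_matrix E 0 t $ i $ j))"

text \<open>\<open>H(Z(t) | Z(0))\<close>\<close>

definition cond_entropy ::
  "('n::finite \<Rightarrow> 'n \<Rightarrow> bool) \<Rightarrow> 'w measure \<Rightarrow> (real \<Rightarrow> 'w \<Rightarrow> 'n) \<Rightarrow> real \<Rightarrow> real" where
  "cond_entropy E M Z t =
     (\<Sum>i\<in>UNIV. measure M {w \<in> space M. Z 0 w = i} * row_entropy E t i)"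

definition lq_norm :: "real \<Rightarrow> real^'n \<Rightarrow> real" where
  "lq_norm q x = (\<Sum>i\<in>UNIV. \<bar>x $ i\<bar> powr q) powr (1 / q)"

definition uniform_dist :: "real^'n" where
  "uniform_dist = (\<chi> i. 1 / real CARD('n))"

end

theory Submission
  imports Defs
begin

text \<open>
  Because \<open>p(0)\<close> sums to \<open>1\<close>, the left-hand side is the \<open>p(0)\<close>-average over \<open>i\<close> of
  \<open>log N - H\<^sub>i(t | 0)\<close>, which is the relative entropy of row \<open>i\<close> from the uniform distribution.
  Pinsker's inequality (\<open>pinsker\<close>) bounds it below by half the squared \<open>\<ell>\<^sup>1\<close>-distance, and
  the \<open>\<ell>\<^sup>q\<close>-norm never exceeds the \<open>\<ell>\<^sup>1\<close>-norm (\<open>lq_norm_le_l1\<close>).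

  Pinsker's inequality is for probability vectors, so the rows of \<open>exp (-t L)\<close> must be recognised as
  such. Only nodes with \<open>p\<^sub>i(0) > 0\<close> contribute to either side, and for those the Markov property
  identifies the row with the conditional distribution of \<open>Z(t)\<close> given \<open>Z(0) = i\<close>
  (\<open>joint_law\<close>).
\<close>

text \<open>
  The difference of the two sides vanishes at \<open>x = 1\<close> together with its derivative, and it is convex:
  its second derivative is \<open>4 (ln x + 1 / x - 1)\<close>, which is nonnegative because
  \<open>ln (1 / x) \<le> 1 / x - 1\<close>. The tangent at \<open>1\<close> therefore bounds it below by \<open>0\<close>.
\<close>

lemma pinsker_pointwise_unit:
  fixes x :: real
  assumes "x > 0"
  shows "3 * (x - 1)\<^sup>2 \<le> (4 + 2 * x) * (x * ln x - x + 1)"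
proof -
  define h where "h y = (4 + 2 * y) * (y * ln y - y + 1) - 3 * (y - 1)\<^sup>2" for y :: real
  define h' where "h' y = 4 * ((1 + y) * ln y - 2 * (y - 1))" for y :: real
  have h: "(h has_real_derivative h' y) (at y)" if "y > 0" for y
    unfolding h_def h'_def
    using that by (auto intro!: derivative_eq_intros simp: field_simps power2_eq_square)
  have h': "(h' has_real_derivative 4 * (ln y + 1 / y - 1)) (at y)" if "y > 0" for y
    unfolding h'_def
    using that by (auto intro!: derivative_eq_intros simp: field_simps)
  have pos: "0 \<le> 4 * (ln y + 1 / y - 1)" if "y > 0" for y :: real
    using ln_le_minus_one[of "1 / y"] that by (simp add: ln_div)
  have "convex_on {0<..} h"
    by (rule f''_ge0_imp_convex[OF _ h h' pos]) auto
  then have "h x - h 1 \<ge> h' 1 * (x - 1)"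
    by (rule convex_on_imp_above_tangent)
      (use assms h[of 1] in \<open>auto simp: has_field_derivative_at_within interior_open\<close>)
  then show ?thesis
    by (simp add: h_def h'_def)
qed

lemma pinsker_pointwise:
  fixes a b :: real
  assumes "a \<ge> 0" "b > 0"
  shows "3 * (a - b)\<^sup>2 \<le> (4 * b + 2 * a) * (a * ln (a / b) - a + b)"
proof (cases "a = 0")
  case True
  then show ?thesis using assms by (simp add: power2_eq_square)
next
  case False
  define x where "x = a / b"
  have a: "a = b * x" and x: "x > 0"
    using assms False by (simp_all add: x_def)
  have "3 * (a - b)\<^sup>2 = b\<^sup>2 * (3 * (x - 1)\<^sup>2)"
    by (simp add: a power2_eq_square algebra_simps)
  also have "\<dots> \<le> b\<^sup>2 * ((4 + 2 * x) * (x * ln x - x + 1))"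
    by (intro mult_left_mono pinsker_pointwise_unit x) simp
  also have "\<dots> = (4 * b + 2 * a) * (a * ln (a / b) - a + b)"
    using assms by (simp add: a power2_eq_square algebra_simps)
  finally show ?thesis .
qed

text \<open>
  The pointwise bound exhibits \<open>\<bar>p i - r i\<bar>\<close> as at most a product \<open>sqrt u \<cdot> sqrt v\<close>, where
  \<open>u = (4 r i + 2 p i) / 3\<close> sums to \<open>2\<close> and \<open>v = p i ln (p i / r i) - p i + r i\<close> sums to the relative
  entropy. The Cauchy--Schwarz inequality combines them.
\<close>

theorem pinsker:
  fixes p r :: "'a \<Rightarrow> real"
  assumes p: "\<And>i. i \<in> A \<Longrightarrow> p i \<ge> 0" and r: "\<And>i. i \<in> A \<Longrightarrow> r i > 0"
    and sum_p: "sum p A = 1" and sum_r: "sum r A = 1"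
  shows "(\<Sum>i\<in>A. \<bar>p i - r i\<bar>)\<^sup>2 \<le> 2 * (\<Sum>i\<in>A. p i * ln (p i / r i))"
proof -
  define u where "u i = (4 * r i + 2 * p i) / 3" for i
  define v where "v i = p i * ln (p i / r i) - p i + r i" for i
  have u: "u i > 0" if "i \<in> A" for i
    using p[OF that] r[OF that] by (simp add: u_def)
  have uv: "(p i - r i)\<^sup>2 \<le> u i * v i" if "i \<in> A" for i
    using pinsker_pointwise[OF p[OF that] r[OF that]] by (simp add: u_def v_def)
  have v: "v i \<ge> 0" if "i \<in> A" for i
    using order_trans[OF zero_le_power2 uv[OF that]] u[OF that] by (simp add: zero_le_mult_iff)
  have "(\<Sum>i\<in>A. \<bar>p i - r i\<bar>)\<^sup>2 \<le> (\<Sum>i\<in>A. sqrt (u i) * sqrt (v i))\<^sup>2"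
    using uv by (intro power_mono sum_mono sum_nonneg)
      (auto simp: real_sqrt_mult[symmetric] intro!: real_le_rsqrt)
  also have "\<dots> \<le> (\<Sum>i\<in>A. (sqrt (u i))\<^sup>2) * (\<Sum>i\<in>A. (sqrt (v i))\<^sup>2)"
    by (rule Cauchy_Schwarz_ineq_sum)
  also have "\<dots> = sum u A * sum v A"
    using u v by (simp add: less_imp_le)
  also have "sum u A = 2"
    by (simp add: u_def sum_divide_distrib[symmetric] sum.distrib sum_distrib_left[symmetric]
        sum_p sum_r)
  also have "sum v A = (\<Sum>i\<in>A. p i * ln (p i / r i))"
    by (simp add: v_def sum.distrib sum_subtractf sum_p sum_r)
  finally show ?thesis .
qed

text \<open>
  With \<open>s\<close> the \<open>\<ell>\<^sup>1\<close>-norm, every entry satisfies \<open>\<bar>x\<^sub>i\<bar> \<le> s\<close>, hence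
  \<open>\<bar>x\<^sub>i\<bar>\<^sup>q \<le> \<bar>x\<^sub>i\<bar> s\<^bsup>q-1\<^esup>\<close>; these bounds sum to \<open>s\<^sup>q\<close>.
\<close>

lemma lq_norm_le_l1:
  assumes "q \<ge> 1"
  shows "lq_norm q x \<le> (\<Sum>i\<in>UNIV. \<bar>x $ i\<bar>)"
proof -
  define s where "s = (\<Sum>i\<in>UNIV. \<bar>x $ i\<bar>)"
  have s: "s \<ge> 0"
    unfolding s_def by (rule sum_nonneg) simp
  have le: "\<bar>x $ i\<bar> \<le> s" for i
    unfolding s_def by (rule member_le_sum) auto
  have "(\<Sum>i\<in>UNIV. \<bar>x $ i\<bar> powr q) = (\<Sum>i\<in>UNIV. \<bar>x $ i\<bar> * \<bar>x $ i\<bar> powr (q - 1))"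
    by (simp add: powr_mult_base)
  also have "\<dots> \<le> (\<Sum>i\<in>UNIV. \<bar>x $ i\<bar> * s powr (q - 1))"
    using le assms by (intro sum_mono mult_left_mono powr_mono2) auto
  also have "\<dots> = s powr q"
    using s by (simp add: sum_distrib_right[symmetric] s_def[symmetric] powr_mult_base)
  finally have "lq_norm q x \<le> (s powr q) powr (1 / q)"
    unfolding lq_norm_def using assms by (intro powr_mono2 sum_nonneg) auto
  also have "\<dots> = s"
    using s assms by (simp add: powr_powr)
  finally show ?thesis by (simp add: s_def)
qed

lemma lq_norm_nonneg: "lq_norm q x \<ge> 0"
  by (simp add: lq_norm_def)

text \<open>
  Pinsker's inequality against the uniform distribution, whose relative entropy is the deficit of the
  Shannon entropy from its maximum \<open>ln N\<close>.
\<close>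

lemma entropy_deficit_ge_lq_dist:
  fixes x :: "real^'n::finite"
  assumes nonneg: "\<And>j. x $ j \<ge> 0" and sum1: "(\<Sum>j\<in>UNIV. x $ j) = 1" and q: "q \<ge> 1"
  shows "(lq_norm q (x - uniform_dist))\<^sup>2 / 2
    \<le> ln (real CARD('n)) + (\<Sum>j\<in>UNIV. x $ j * ln (x $ j))"
proof -
  let ?N = "real CARD('n)"
  have "(lq_norm q (x - uniform_dist))\<^sup>2 \<le> (\<Sum>j\<in>UNIV. \<bar>(x - uniform_dist) $ j\<bar>)\<^sup>2"
    by (intro power_mono lq_norm_le_l1 lq_norm_nonneg q)
  also have "\<dots> = (\<Sum>j\<in>UNIV. \<bar>x $ j - 1 / ?N\<bar>)\<^sup>2"
    by (simp add: uniform_dist_def)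
  also have "\<dots> \<le> 2 * (\<Sum>j\<in>UNIV. x $ j * ln (x $ j / (1 / ?N)))"
    by (rule pinsker) (use nonneg sum1 in auto)
  also have "(\<Sum>j\<in>UNIV. x $ j * ln (x $ j / (1 / ?N)))
      = (\<Sum>j\<in>UNIV. x $ j * ln (x $ j) + x $ j * ln ?N)"
  proof (rule sum.cong[OF refl])
    fix j
    show "x $ j * ln (x $ j / (1 / ?N)) = x $ j * ln (x $ j) + x $ j * ln ?N"
      using nonneg[of j] by (cases "x $ j = 0") (auto simp: ln_mult algebra_simps)
  qed
  also have "\<dots> = ln ?N + (\<Sum>j\<in>UNIV. x $ j * ln (x $ j))"
    by (simp add: sum.distrib sum_distrib_right[symmetric] sum1)
  finally show ?thesis by simp
qed

context heat_diffusion
begin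

lemma measurable_event: "t \<ge> 0 \<Longrightarrow> {w \<in> space M. Z t w = j} \<in> events"
  using measurable_sets[OF Z_measurable, of t "{j}"] by (simp add: vimage_def Int_def conj_commute)

lemma sum_prob_decompose:
  assumes "t \<ge> 0" "A \<in> events"
  shows "(\<Sum>j\<in>UNIV. prob {w \<in> A. Z t w = j}) = prob A"
proof -
  have eq: "{w \<in> A. Z t w = j} = A \<inter> {w \<in> space M. Z t w = j}" for j
    using sets.sets_into_space[OF assms(2)] by auto
  have "prob (\<Union>j\<in>UNIV. {w \<in> A. Z t w = j}) = (\<Sum>j\<in>UNIV. prob {w \<in> A. Z t w = j})"
    by (rule finite_measure_finite_Union)
      (auto simp: disjoint_family_on_def eq intro!: assms measurable_event)
  moreover have "(\<Union>j\<in>UNIV. {w \<in> A. Z t w = j}) = A"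
    by auto
  ultimately show ?thesis by simp
qed

lemma initial_sum: "(\<Sum>i\<in>UNIV. p0 $ i) = 1"
  using sum_prob_decompose[of 0 "space M"] by (simp add: initial prob_space)

text \<open>
  This is the Markov property at \<open>s = 0\<close> with no earlier times. Where \<open>p\<^sub>i(0) > 0\<close>, dividing by it
  turns row \<open>i\<close> into a conditional distribution, hence a probability vector; where \<open>p\<^sub>i(0) = 0\<close>, it
  carries no information about the row.
\<close>

lemma joint_law:
  assumes "t \<ge> 0"
  shows "prob {w \<in> space M. Z 0 w = i \<and> Z t w = j} = p0 $ i * transition_matrix E 0 t $ i $ j"
  using markov[of 0 t "{}" _ i j] assms by (simp add: initial)

lemma transition_row_nonneg:
  assumes "t \<ge> 0" "p0 $ i > 0"
  shows "transition_matrix E 0 t $ i $ j \<ge> 0"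
proof -
  have "0 \<le> p0 $ i * transition_matrix E 0 t $ i $ j"
    unfolding joint_law[OF assms(1), symmetric] by simp
  then show ?thesis
    using assms(2) by (simp add: zero_le_mult_iff)
qed

lemma transition_row_sum:
  assumes "t \<ge> 0" "p0 $ i > 0"
  shows "(\<Sum>j\<in>UNIV. transition_matrix E 0 t $ i $ j) = 1"
proof -
  have "p0 $ i * (\<Sum>j\<in>UNIV. transition_matrix E 0 t $ i $ j) = p0 $ i"
    using sum_prob_decompose[OF assms(1) measurable_event[of 0 i]]
    by (simp add: sum_distrib_left joint_law[OF assms(1)] initial)
  then show ?thesis
    using assms(2) by simp
qed

end

theorem proposition3p14:
  fixes E :: "'n::finite \<Rightarrow> 'n \<Rightarrow> bool" and M :: "'w measure"
    and p0 :: "real^'n" and Z :: "real \<Rightarrow> 'w \<Rightarrow> 'n" and t q :: real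
  assumes "heat_diffusion E M p0 Z"
    and "t \<ge> 0"
    and "q \<ge> 1"
  shows "ln (real CARD('n)) - cond_entropy E M Z t
    \<ge> (\<Sum>i\<in>UNIV. p0 $ i / 2 * (lq_norm q (row i (transition_matrix E 0 t) - uniform_dist))\<^sup>2)"
proof -
  interpret heat_diffusion E M p0 Z by fact
  let ?d = "\<lambda>i. lq_norm q (row i (transition_matrix E 0 t) - uniform_dist)"
  have "p0 $ i / 2 * (?d i)\<^sup>2 \<le> p0 $ i * (ln (real CARD('n)) - row_entropy E t i)" for i
  proof (cases "p0 $ i = 0")
    case True
    then show ?thesis by simp
  next
    case False
    have "p0 $ i \<ge> 0"
      using initial[of i] measure_nonneg by metis
    with False have pos: "p0 $ i > 0" by simp
    have le: "(?d i)\<^sup>2 / 2 \<le> ln (real CARD('n)) - row_entropy E t i"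
      using entropy_deficit_ge_lq_dist[of "row i (transition_matrix E 0 t)" q] assms(3)
        transition_row_nonneg[OF assms(2) pos] transition_row_sum[OF assms(2) pos]
      by (simp add: row_def row_entropy_def)
    show ?thesis
      using mult_left_mono[OF le less_imp_le[OF pos]] by simp
  qed
  then have "(\<Sum>i\<in>UNIV. p0 $ i / 2 * (?d i)\<^sup>2)
      \<le> (\<Sum>i\<in>UNIV. p0 $ i * (ln (real CARD('n)) - row_entropy E t i))"
    by (intro sum_mono)
  also have "\<dots> = ln (real CARD('n)) - cond_entropy E M Z t"
    by (simp add: cond_entropy_def initial right_diff_distrib sum_subtractf
        sum_distrib_right[symmetric] initial_sum)
  finally show ?thesis .
qed

end
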